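(* Let $P$ be a probability measure on a measurable space $\mathcal{X}$, let $B>0$, and let $\mathcal{F}$ be a nonempty class of measurable functions $f:\mathcal{X}\to[-B,B]$. Suppose there is a constant $C_{\mathcal{F}}\ge0$ (not depending on $\sigma$ or on the sample size) such that, for every $\sigma>0$ and every integer $m\ge0$, in the regression model with $X_1,\dots,X_m$ i.i.d. from $P$ and $Y_i=f(X_i)+\epsilon_i$, where the $\epsilon_i$ are i.i.d. Normal$(0,\sigma^2)$ independent of the $X_i$, there is an estimator $\hat f_m$ based on $((X_i,Y_i):i=1,\dots,m)$ with $$\sup_{f\in\mathcal{F}}E\big[\|f-\hat f_m\|^2\big]\le (B+\sigma)\frac{C_{\mathcal{F}}}{\sqrt{\max\{m,1\}}},$$ where $\|\cdot\|$ is the $L_2(P)$ norm. Then for all $\epsilon>0$, $$\log N(\epsilon,\mathcal{F})\le\frac{16\,C_{\mathcal{F}}^2}{\epsilon^2}+2\log2.$$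
   Context: $N(\epsilon,\mathcal{F})$ is the size of a maximal $\epsilon$-packing of $\mathcal{F}$ with respect to the $L_2(P)$ distance, i.e. the largest size of a subset of $\mathcal{F}$ whose distinct members are at $L_2(P)$ distance greater than $\epsilon$. An estimator $\hat f_m$ is a (jointly measurable) real function on $\mathcal{X}$ depending on the data; $\hat f_0$ uses no data. Logarithms are natural. *)

theory Defs
  imports "HOL-Probability.Probability" "HOL-Library.Extended_Nat"
begin

text \<open>
  The squared \<open>L\<^sub>2(P)\<close> norm is a nonnegative extended integral, so that a function that is not
  square integrable has squared norm \<open>\<infinity>\<close> (a Bochner integral would give \<open>0\<close>).
\<close>

definition l2_norm_sq :: "'a measure \<Rightarrow> ('a \<Rightarrow> real) \<Rightarrow> ennreal" where
  "l2_norm_sq P g = (\<integral>\<^sup>+ x. ennreal ((g x)\<^sup>2) \<partial>P)"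

text \<open>
  The real-valued distance is meaningful when the difference is square integrable; below it is
  only applied to uniformly bounded functions.
\<close>

definition l2_dist :: "'a measure \<Rightarrow> ('a \<Rightarrow> real) \<Rightarrow> ('a \<Rightarrow> real) \<Rightarrow> real" where
  "l2_dist P f g = sqrt (enn2real (l2_norm_sq P (\<lambda>x. f x - g x)))"

definition is_packing :: "'a measure \<Rightarrow> real \<Rightarrow> ('a \<Rightarrow> real) set \<Rightarrow> ('a \<Rightarrow> real) set \<Rightarrow> bool" where
  "is_packing P \<epsilon> F S \<longleftrightarrow> S \<subseteq> F \<and> (\<forall>f\<in>S. \<forall>g\<in>S. f \<noteq> g \<longrightarrow> l2_dist P f g > \<epsilon>)"

definition packing_number :: "'a measure \<Rightarrow> real \<Rightarrow> ('a \<Rightarrow> real) set \<Rightarrow> enat" where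
  "packing_number P \<epsilon> F =
     (SUP S \<in> {S. is_packing P \<epsilon> F S}. if finite S then enat (card S) else \<infinity>)"

text \<open>
  A point \<open>\<omega>\<close> of the sample space lists the independent pairs \<open>\<omega> i = (X\<^sub>i, \<epsilon>\<^sub>i)\<close>, \<open>i = 1, \<dots>, m\<close>,
  with \<open>X\<^sub>i\<close> distributed as \<open>P\<close> and \<open>\<epsilon>\<^sub>i\<close> as Normal\<open>(0, \<sigma>\<^sup>2)\<close> (the second argument of
  \<^const>\<open>normal_density\<close> is the standard deviation).
\<close>

definition sample_space :: "'a measure \<Rightarrow> real \<Rightarrow> nat \<Rightarrow> (nat \<Rightarrow> 'a \<times> real) measure" where
  "sample_space P \<sigma> m =
     PiM {1..m} (\<lambda>_. P \<Otimes>\<^sub>M density lborel (\<lambda>e. ennreal (normal_density 0 \<sigma> e)))"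

definition regression_data :: "('a \<Rightarrow> real) \<Rightarrow> nat \<Rightarrow> (nat \<Rightarrow> 'a \<times> real) \<Rightarrow> (nat \<Rightarrow> 'a \<times> real)" where
  "regression_data f m \<omega> = (\<lambda>i\<in>{1..m}. (fst (\<omega> i), f (fst (\<omega> i)) + snd (\<omega> i)))"

text \<open>
  For \<open>m = 0\<close> the data space has a single point, so the estimator uses no data.
\<close>

definition is_estimator :: "'a measure \<Rightarrow> nat \<Rightarrow> ((nat \<Rightarrow> 'a \<times> real) \<Rightarrow> 'a \<Rightarrow> real) \<Rightarrow> bool" where
  "is_estimator P m fhat \<longleftrightarrow>
     (\<lambda>(d, x). fhat d x) \<in> borel_measurable (PiM {1..m} (\<lambda>_. P \<Otimes>\<^sub>M borel) \<Otimes>\<^sub>M P)"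

definition risk ::
  "'a measure \<Rightarrow> real \<Rightarrow> nat \<Rightarrow> ((nat \<Rightarrow> 'a \<times> real) \<Rightarrow> 'a \<Rightarrow> real) \<Rightarrow> ('a \<Rightarrow> real) \<Rightarrow> ennreal" where
  "risk P \<sigma> m fhat f =
     (\<integral>\<^sup>+ \<omega>. l2_norm_sq P (\<lambda>x. f x - fhat (regression_data f m \<omega>) x) \<partial>sample_space P \<sigma> m)"

end

theory Submission
  imports Defs "HOL-Real_Asymp.Real_Asymp"
begin

text \<open>
  Sequential Fano argument. Fix a finite packing \<open>S\<close> of size \<open>N\<close>, a sample size \<open>m\<close> and estimators
  with risks \<open>r\<^sub>0, \<dots>, r\<^sub>m\<close>. The estimators give a predictive law of the data: conditionally on
  the past and on \<open>X\<^sub>i\<close>, the response \<open>Y\<^sub>i\<close> is normal, centred at the value predicted from the first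
  \<open>i - 1\<close> observations. The chain rule bounds the relative entropy of the data law of any \<open>f \<in> S\<close>
  with respect to it by \<open>(r\<^sub>0 + \<dots> + r\<^sub>m\<^sub>-\<^sub>1) / (2 \<sigma>\<^sup>2)\<close>. Decoding \<open>f\<close> from the final estimator, which
  fails with probability at most \<open>4 r\<^sub>m / \<epsilon>\<^sup>2\<close>, gives
  \<open>(1 - 4 r\<^sub>m / \<epsilon>\<^sup>2) ln N \<le> (r\<^sub>0 + \<dots> + r\<^sub>m\<^sub>-\<^sub>1) / (2 \<sigma>\<^sup>2) + ln 2\<close>. With \<open>\<sigma> = sqrt m / \<tau>\<close> and \<open>m \<rightarrow> \<infinity>\<close>
  the range bound \<open>B\<close> disappears and \<open>(1 - 4 C / (\<tau> \<epsilon>\<^sup>2)) ln N \<le> C \<tau> + ln 2\<close> remains; take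
  \<open>\<tau> = 8 C / \<epsilon>\<^sup>2\<close>. Since the data law of the zero function is the sample space itself, it serves as
  the reference measure for all densities.
\<close>

section \<open>The sample space as a product measure, and measurability of the data\<close>

locale gaussian_regression = prob_space P for P :: "'a measure" +
  fixes \<sigma> :: real
  assumes sigma_pos: "0 < \<sigma>"
begin

abbreviation noise :: "real measure" where
  "noise \<equiv> density lborel (\<lambda>e. ennreal (normal_density 0 \<sigma> e))"

abbreviation observation :: "('a \<times> real) measure" where
  "observation \<equiv> P \<Otimes>\<^sub>M noise"

sublocale noise: prob_space noise
  by (rule prob_space_normal_density[OF sigma_pos])

sublocale observation: pair_prob_space P noise ..

sublocale sample: product_prob_space "\<lambda>_::nat. observation" UNIV ..

lemma sample_space_eq: "sample_space P \<sigma> m = PiM {1..m} (\<lambda>_. observation)"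
  by (simp add: sample_space_def)

lemma sets_observation [measurable_cong]: "sets observation = sets (P \<Otimes>\<^sub>M borel)"
  by (intro sets_pair_measure_cong) auto

text \<open>Measurability can thus be proved over the plain Borel product, whose sigma-algebra does
  not mention the noise density, and transferred to the sample space automatically.\<close>

lemma sets_sample_space [measurable_cong]:
  "sets (sample_space P \<sigma> m) = sets (PiM {1..m} (\<lambda>_. P \<Otimes>\<^sub>M borel))"
  unfolding sample_space_eq by (intro sets_PiM_cong sets_observation refl)

lemma prob_space_sample_space: "prob_space (sample_space P \<sigma> m)"
  unfolding sample_space_eq by (intro prob_space_PiM) unfold_locales

lemma nn_integral_sample_space_Suc:
  assumes "h \<in> borel_measurable (sample_space P \<sigma> (Suc m))"
  shows "(\<integral>\<^sup>+ w. h w \<partial>sample_space P \<sigma> (Suc m)) =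
    (\<integral>\<^sup>+ w. \<integral>\<^sup>+z. h (w(Suc m := z)) \<partial>observation \<partial>sample_space P \<sigma> m)"
proof -
  have "{1..Suc m} = insert (Suc m) {1..m}" by auto
  then show ?thesis
    using assms sample.product_nn_integral_insert[of "{1..m}" "Suc m" h]
    by (simp add: sample_space_eq)
qed

lemma integral_sample_space_Suc:
  fixes h :: "(nat \<Rightarrow> 'a \<times> real) \<Rightarrow> real"
  assumes "integrable (sample_space P \<sigma> (Suc m)) h"
  shows "(\<integral>w. h w \<partial>sample_space P \<sigma> (Suc m)) =
    (\<integral>w. \<integral>z. h (w(Suc m := z)) \<partial>observation \<partial>sample_space P \<sigma> m)"
proof -
  have "{1..Suc m} = insert (Suc m) {1..m}" by auto
  then show ?thesis
    using assms sample.product_integral_insert[of "{1..m}" "Suc m" h]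
    by (simp add: sample_space_eq)
qed

lemma distr_sample_space_restrict:
  assumes "k \<le> m"
  shows "distr (sample_space P \<sigma> m) (sample_space P \<sigma> k) (\<lambda>w. restrict w {1..k}) = sample_space P \<sigma> k"
  unfolding sample_space_eq using assms sample.distr_restrict[of "{1..k}" "{1..m}"] by simp

lemma measurable_restrict_sample [measurable]:
  fixes k m :: nat
  assumes "k \<le> m"
  shows "(\<lambda>w. restrict w {1..k}) \<in> PiM {1..m} (\<lambda>_. P \<Otimes>\<^sub>M borel) \<rightarrow>\<^sub>M PiM {1..k} (\<lambda>_. P \<Otimes>\<^sub>M (borel :: real measure))"
  by (rule measurable_restrict_subset) (use assms in simp)

lemma measurable_regression_data [measurable]:
  assumes [measurable]: "f \<in> borel_measurable P" and "k \<le> m"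
  shows "regression_data f k \<in> PiM {1..m} (\<lambda>_. P \<Otimes>\<^sub>M borel) \<rightarrow>\<^sub>M PiM {1..k} (\<lambda>_. P \<Otimes>\<^sub>M borel)"
  unfolding regression_data_def[abs_def]
proof (rule measurable_restrict)
  fix i assume "i \<in> {1..k}"
  with \<open>k \<le> m\<close> have [measurable]: "i \<in> {1..m}" by auto
  show "(\<lambda>w. (fst (w i), f (fst (w i)) + snd (w i)))
      \<in> PiM {1..m} (\<lambda>_. P \<Otimes>\<^sub>M borel) \<rightarrow>\<^sub>M P \<Otimes>\<^sub>M borel"
    by measurable
qed

section \<open>Gaussian likelihood ratios and moments of the noise\<close>

text \<open>The likelihood ratio of Normal\<open>(c, \<sigma>\<^sup>2)\<close> with respect to Normal\<open>(0, \<sigma>\<^sup>2)\<close>.\<close>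

definition tilt :: "real \<Rightarrow> real \<Rightarrow> real" where
  "tilt c y = exp ((2 * y * c - c\<^sup>2) / (2 * \<sigma>\<^sup>2))"

lemma tilt_pos [simp]: "0 < tilt c y"
  by (simp add: tilt_def)

lemma measurable_tilt [measurable]:
  assumes [measurable]: "f \<in> borel_measurable M" "g \<in> borel_measurable M"
  shows "(\<lambda>x. tilt (f x) (g x)) \<in> borel_measurable M"
  unfolding tilt_def by measurable

lemma normal_density_tilt: "normal_density 0 \<sigma> y * tilt c y = normal_density 0 \<sigma> (y - c)"
  using sigma_pos
  by (simp add: normal_density_def tilt_def mult_exp_exp flip: diff_divide_distrib add_divide_distrib)
    (simp add: power2_eq_square field_simps)

text \<open>Translation invariance of Lebesgue measure moves the shift from the argument of
  \<open>h\<close> to the normal density, where it becomes the factor \<open>tilt c\<close>.\<close>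

lemma nn_integral_noise_shift:
  assumes [measurable]: "h \<in> borel_measurable borel"
  shows "(\<integral>\<^sup>+e. h (c + e) \<partial>noise) = (\<integral>\<^sup>+y. h y * ennreal (tilt c y) \<partial>noise)"
proof -
  have "(\<integral>\<^sup>+y. h y * ennreal (tilt c y) \<partial>noise) =
      (\<integral>\<^sup>+y. ennreal (normal_density 0 \<sigma> (y - c)) * h y \<partial>lborel)"
    unfolding normal_density_tilt[symmetric]
    by (subst nn_integral_density) (auto simp: ennreal_mult less_imp_le mult_ac)
  also have "\<dots> = (\<integral>\<^sup>+e. ennreal (normal_density 0 \<sigma> e) * h (c + e) \<partial>lborel)"
    by (subst nn_integral_real_affine[where c=1 and t=c]) auto
  also have "\<dots> = (\<integral>\<^sup>+e. h (c + e) \<partial>noise)"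
    by (subst nn_integral_density) auto
  finally show ?thesis ..
qed

lemma nn_integral_tilt: "(\<integral>\<^sup>+y. ennreal (tilt c y) \<partial>noise) = 1"
  using nn_integral_noise_shift[of "\<lambda>_. 1" c] noise.emeasure_space_1 by simp

lemma nn_integral_observation_shift:
  assumes [measurable]: "f \<in> borel_measurable P" "h \<in> borel_measurable (P \<Otimes>\<^sub>M borel)"
  shows "(\<integral>\<^sup>+z. h (fst z, f (fst z) + snd z) \<partial>observation) =
    (\<integral>\<^sup>+z. h z * ennreal (tilt (f (fst z)) (snd z)) \<partial>observation)"
proof -
  have "(\<integral>\<^sup>+z. h (fst z, f (fst z) + snd z) \<partial>observation) =
      (\<integral>\<^sup>+x. \<integral>\<^sup>+e. h (x, f x + e) \<partial>noise \<partial>P)"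
    by (subst noise.nn_integral_fst[symmetric]) auto
  also have "\<dots> = (\<integral>\<^sup>+x. \<integral>\<^sup>+y. h (x, y) * ennreal (tilt (f x) y) \<partial>noise \<partial>P)"
    by (intro nn_integral_cong nn_integral_noise_shift) auto
  also have "\<dots> = (\<integral>\<^sup>+z. h z * ennreal (tilt (f (fst z)) (snd z)) \<partial>observation)"
    by (subst noise.nn_integral_fst[symmetric]) auto
  finally show ?thesis .
qed

text \<open>By Fubini the centred noise integrates to 0 at each fixed covariate. If the product is
  not integrable, its Bochner integral is 0 by convention, so the identity holds in both
  cases.\<close>

lemma integral_noise_mult:
  fixes g :: "'a \<Rightarrow> real"
  assumes [measurable]: "g \<in> borel_measurable P"
  shows "(\<integral>z. snd z * g (fst z) \<partial>observation) = 0"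
proof (cases "integrable observation (\<lambda>z. snd z * g (fst z))")
  case True
  have "(\<integral>e. e \<partial>noise) = 0"
    using integral_normal_moment_nz_1[OF sigma_pos, of 0] by (simp add: integral_density)
  moreover have "(\<integral>z. snd z * g (fst z) \<partial>observation) = (\<integral>x. \<integral>e. e * g x \<partial>noise \<partial>P)"
    using observation.integral_fst'[OF True] by simp
  ultimately show ?thesis by simp
qed (rule not_integrable_integral_eq)

lemma nn_integral_noise_square: "(\<integral>\<^sup>+z. ennreal ((snd z)\<^sup>2) \<partial>observation) < \<infinity>"
proof -
  have "integrable lborel (\<lambda>e. normal_density 0 \<sigma> e * e\<^sup>2)"
    using integrable_normal_moment[OF sigma_pos, of 0 2] by simp
  then have "(\<integral>\<^sup>+e. ennreal (normal_density 0 \<sigma> e * e\<^sup>2) \<partial>lborel) < \<infinity>"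
    by (simp add: integrable_iff_bounded)
  then have "(\<integral>\<^sup>+e. ennreal (e\<^sup>2) \<partial>noise) < \<infinity>"
    by (subst nn_integral_density) (auto simp: ennreal_mult)
  then show ?thesis
    by (subst noise.nn_integral_fst[symmetric]) (auto simp: emeasure_space_1)
qed


section \<open>The data law of a regression function and its density\<close>

lemma measurable_update [measurable]:
  "(\<lambda>(d, z). d(Suc m := z)) \<in> PiM {1..m} (\<lambda>_. P \<Otimes>\<^sub>M borel) \<Otimes>\<^sub>M (P \<Otimes>\<^sub>M (borel :: real measure))
    \<rightarrow>\<^sub>M PiM {1..Suc m} (\<lambda>_. P \<Otimes>\<^sub>M borel)"
proof -
  have "{1..Suc m} = insert (Suc m) {1..m}" by auto
  then show ?thesis
    using measurable_add_dim[of "Suc m" "{1..m}" "\<lambda>_. P \<Otimes>\<^sub>M (borel :: real measure)"] by simp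
qed

lemma measurable_update_compose:
  assumes "h \<in> PiM {1..Suc m} (\<lambda>_. P \<Otimes>\<^sub>M borel) \<rightarrow>\<^sub>M N"
  shows "(\<lambda>(d, z). h (d(Suc m := z))) \<in> PiM {1..m} (\<lambda>_. P \<Otimes>\<^sub>M borel) \<Otimes>\<^sub>M (P \<Otimes>\<^sub>M (borel :: real measure)) \<rightarrow>\<^sub>M N"
  using measurable_compose[OF measurable_update assms] by (simp add: split_beta')

lemma space_sample_space:
  "space (sample_space P \<sigma> m) = space (PiM {1..m} (\<lambda>_. P \<Otimes>\<^sub>M (borel :: real measure)))"
  by (rule sets_eq_imp_space_eq[OF sets_sample_space])

lemma regression_data_Suc_upd:
  "regression_data f (Suc m) (w(Suc m := z)) =
    (regression_data f m w)(Suc m := (fst z, f (fst z) + snd z))"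
  by (auto simp: regression_data_def fun_eq_iff)

lemma restrict_regression_data:
  "i \<le> m \<Longrightarrow> restrict (regression_data f m w) {1..i} = regression_data f i w"
  by (auto simp: regression_data_def fun_eq_iff)

text \<open>Induction on the sample size. The last observation is split off, its response is shifted
  by the one-step change of measure while the past stays fixed, and the induction hypothesis is
  applied to the inner integral as a function of the past; hence \<open>h\<close> must be
  arbitrary.\<close>

lemma nn_integral_regression_data:
  assumes f [measurable]: "f \<in> borel_measurable P"
    and "h \<in> borel_measurable (PiM {1..m} (\<lambda>_. P \<Otimes>\<^sub>M borel))"
  shows "(\<integral>\<^sup>+ w. h (regression_data f m w) \<partial>sample_space P \<sigma> m) =
    (\<integral>\<^sup>+ d. h d * ennreal (\<Prod>i<m. tilt (f (fst (d (Suc i)))) (snd (d (Suc i)))) \<partial>sample_space P \<sigma> m)"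
  using assms(2)
proof (induction m arbitrary: h)
  case 0
  \<comment> \<open>Over the empty index set the only point is the function that is
    \<open>undefined\<close> everywhere, and this is also the empty data set.\<close>
  have "regression_data f 0 w = w" if "w \<in> space (sample_space P \<sigma> 0)" for w
    using that by (auto simp: space_sample_space space_PiM regression_data_def)
  then show ?case
    by (intro nn_integral_cong) simp
next
  case (Suc m)
  note [measurable] = Suc.prems measurable_update_compose[OF Suc.prems]
  let ?p = "\<lambda>m d. \<Prod>i<m. tilt (f (fst (d (Suc i)))) (snd (d (Suc i)))"
  let ?t = "\<lambda>z. tilt (f (fst z)) (snd z)"
  have h_upd: "(\<lambda>z. h (d(Suc m := z))) \<in> borel_measurable (P \<Otimes>\<^sub>M borel)"
    if "d \<in> space (PiM {1..m} (\<lambda>_. P \<Otimes>\<^sub>M borel))" for d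
    using that by measurable
  have rd: "regression_data f m w \<in> space (PiM {1..m} (\<lambda>_. P \<Otimes>\<^sub>M borel))"
    if "w \<in> space (sample_space P \<sigma> m)" for w
    using measurable_space[OF measurable_regression_data[OF f order_refl]] that
    by (simp add: space_sample_space)
  have "(\<integral>\<^sup>+ w. h (regression_data f (Suc m) w) \<partial>sample_space P \<sigma> (Suc m)) =
      (\<integral>\<^sup>+ w. \<integral>\<^sup>+ z. h ((regression_data f m w)(Suc m := (fst z, f (fst z) + snd z))) \<partial>observation
        \<partial>sample_space P \<sigma> m)"
    using measurable_compose[OF measurable_regression_data[OF f order_refl] Suc.prems]
    by (subst nn_integral_sample_space_Suc)
      (auto simp: regression_data_Suc_upd measurable_cong_sets[OF sets_sample_space refl])
  also have "\<dots> = (\<integral>\<^sup>+ w. \<integral>\<^sup>+ z. h ((regression_data f m w)(Suc m := z)) * ennreal (?t z) \<partial>observation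
        \<partial>sample_space P \<sigma> m)"
    by (intro nn_integral_cong nn_integral_observation_shift h_upd rd f)
  also have "\<dots> = (\<integral>\<^sup>+ d. (\<integral>\<^sup>+ z. h (d(Suc m := z)) * ennreal (?t z) \<partial>observation) * ennreal (?p m d)
        \<partial>sample_space P \<sigma> m)"
    by (rule Suc.IH) measurable
  also have "\<dots> = (\<integral>\<^sup>+ d. \<integral>\<^sup>+ z. h (d(Suc m := z)) * ennreal (?p (Suc m) (d(Suc m := z))) \<partial>observation
        \<partial>sample_space P \<sigma> m)"
    using h_upd
    by (intro nn_integral_cong)
      (subst nn_integral_multc[symmetric],
       auto simp: space_sample_space ennreal_mult prod_nonneg less_imp_le mult_ac
         intro!: nn_integral_cong measurable_cong_sets)
  also have "\<dots> = (\<integral>\<^sup>+ d. h d * ennreal (?p (Suc m) d) \<partial>sample_space P \<sigma> (Suc m))"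
    by (subst nn_integral_sample_space_Suc) auto
  finally show ?case .
qed

section \<open>The predictive law built from the estimators\<close>

lemma measurable_prediction [measurable]:
  assumes "is_estimator P i g" and "i < m"
  shows "(\<lambda>d. g (restrict d {1..i}) (fst (d (Suc i)))) \<in> borel_measurable (PiM {1..m} (\<lambda>_. P \<Otimes>\<^sub>M borel))"
proof -
  have [measurable]: "Suc i \<in> {1..m}" and le: "i \<le> m" using assms by auto
  note [measurable] = measurable_restrict_sample[OF le]
  have "(\<lambda>d. (restrict d {1..i}, fst (d (Suc i)))) \<in> PiM {1..m} (\<lambda>_. P \<Otimes>\<^sub>M (borel :: real measure))
      \<rightarrow>\<^sub>M PiM {1..i} (\<lambda>_. P \<Otimes>\<^sub>M borel) \<Otimes>\<^sub>M P"
    by measurable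
  from measurable_compose[OF this assms(1)[unfolded is_estimator_def]]
  show ?thesis by simp
qed

text \<open>
  The density, with respect to the data law for the zero function, of the data law under which
  \<open>Y\<^sub>i\<close> is drawn from the normal distribution centred at the prediction made from the earlier data.
\<close>

definition predictive_density ::
  "(nat \<Rightarrow> (nat \<Rightarrow> 'a \<times> real) \<Rightarrow> 'a \<Rightarrow> real) \<Rightarrow> nat \<Rightarrow> (nat \<Rightarrow> 'a \<times> real) \<Rightarrow> real" where
  "predictive_density g m d =
    (\<Prod>i<m. tilt (g i (restrict d {1..i}) (fst (d (Suc i)))) (snd (d (Suc i))))"

lemma predictive_density_nonneg: "0 \<le> predictive_density g m d"
  by (simp add: predictive_density_def prod_nonneg less_imp_le)

lemma measurable_predictive_density:
  assumes "\<And>i. i < m \<Longrightarrow> is_estimator P i (g i)"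
  shows "predictive_density g m \<in> borel_measurable (PiM {1..m} (\<lambda>_. P \<Otimes>\<^sub>M borel))"
  unfolding predictive_density_def[abs_def]
proof (intro borel_measurable_prod)
  fix i assume "i \<in> {..<m}"
  then have [measurable]: "is_estimator P i (g i)" "i < m" "Suc i \<in> {1..m}" using assms by auto
  show "(\<lambda>d. tilt (g i (restrict d {1..i}) (fst (d (Suc i)))) (snd (d (Suc i))))
      \<in> borel_measurable (PiM {1..m} (\<lambda>_. P \<Otimes>\<^sub>M borel))"
    by measurable
qed

text \<open>Given the past and the next covariate, the prediction is a fixed number, so the last
  factor is the likelihood ratio of a normal law and integrates to 1. Peeling off the observations
  one at a time leaves total mass 1.\<close>

lemma nn_integral_predictive_density:
  assumes "\<And>i. i < m \<Longrightarrow> is_estimator P i (g i)"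
  shows "(\<integral>\<^sup>+ d. ennreal (predictive_density g m d) \<partial>sample_space P \<sigma> m) = 1"
  using assms
proof (induction m)
  case 0
  show ?case
    using prob_space.emeasure_space_1[OF prob_space_sample_space] by (simp add: predictive_density_def)
next
  case (Suc m)
  note [measurable] = measurable_predictive_density[OF Suc.prems]
  have g_meas: "(\<lambda>x. g m d x) \<in> borel_measurable P"
    if "d \<in> space (PiM {1..m} (\<lambda>_. P \<Otimes>\<^sub>M (borel :: real measure)))" for d
    using measurable_compose_Pair1[OF that Suc.prems[of m, unfolded is_estimator_def]] by simp
  have upd: "predictive_density g (Suc m) (d(Suc m := z)) =
      predictive_density g m d * tilt (g m d (fst z)) (snd z)"
    if "d \<in> space (PiM {1..m} (\<lambda>_. P \<Otimes>\<^sub>M (borel :: real measure)))" for d z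
  proof -
    \<comment> \<open>Observation \<open>Suc m\<close> enters only the last factor: the earlier
      factors use coordinates up to \<open>m\<close>, and the last prediction is computed from all
      of \<open>d\<close>.\<close>
    have "restrict d {1..m} = d"
      using that by (auto simp: space_PiM PiE_restrict)
    moreover have "restrict (d(Suc m := z)) {1..i} = restrict d {1..i}" if "i \<le> m" for i
      using that by (auto simp: fun_eq_iff)
    ultimately show ?thesis by (simp add: predictive_density_def)
  qed
  have "(\<integral>\<^sup>+ d. ennreal (predictive_density g (Suc m) d) \<partial>sample_space P \<sigma> (Suc m)) =
    (\<integral>\<^sup>+ d. \<integral>\<^sup>+ z. ennreal (predictive_density g m d) * ennreal (tilt (g m d (fst z)) (snd z)) \<partial>observation
      \<partial>sample_space P \<sigma> m)"
    using predictive_density_nonneg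
    by (subst nn_integral_sample_space_Suc)
      (auto intro!: nn_integral_cong simp: upd space_sample_space ennreal_mult less_imp_le)
  also have "\<dots> = (\<integral>\<^sup>+ d. ennreal (predictive_density g m d) \<partial>sample_space P \<sigma> m)"
  proof (intro nn_integral_cong)
    fix d assume "d \<in> space (sample_space P \<sigma> m)"
    then have [measurable]: "(\<lambda>x. g m d x) \<in> borel_measurable P"
      by (simp add: g_meas space_sample_space)
    have "(\<integral>\<^sup>+ z. ennreal (tilt (g m d (fst z)) (snd z)) \<partial>observation) = 1"
      by (subst noise.nn_integral_fst[symmetric]) (auto simp: nn_integral_tilt emeasure_space_1)
    then show "(\<integral>\<^sup>+ z. ennreal (predictive_density g m d) * ennreal (tilt (g m d (fst z)) (snd z)) \<partial>observation)
        = ennreal (predictive_density g m d)"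
      by (subst nn_integral_cmult) auto
  qed
  also have "\<dots> = 1"
    using Suc by simp
  finally show ?case .
qed


section \<open>Prediction errors and their moments\<close>

text \<open>The first \<open>k\<close> observations have the law of a sample of size
  \<open>k\<close>. A quantity of step \<open>i\<close> can therefore be integrated at sample size
  \<open>Suc i\<close>, where the observation it predicts is the last one and Fubini
  applies.\<close>

lemma nn_integral_restrict_sample:
  assumes "k \<le> m" and [measurable]: "h \<in> borel_measurable (PiM {1..k} (\<lambda>_. P \<Otimes>\<^sub>M borel))"
  shows "(\<integral>\<^sup>+ w. h (restrict w {1..k}) \<partial>sample_space P \<sigma> m) = (\<integral>\<^sup>+ w. h w \<partial>sample_space P \<sigma> k)"
proof -
  have "(\<lambda>w. restrict w {1..k}) \<in> sample_space P \<sigma> m \<rightarrow>\<^sub>M sample_space P \<sigma> k"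
    using measurable_restrict_sample[OF assms(1)]
    by (simp add: measurable_cong_sets[OF sets_sample_space sets_sample_space])
  from nn_integral_distr[OF this, of h] show ?thesis
    by (simp only: distr_sample_space_restrict[OF assms(1)] assms(2) measurable_cong_sets[OF sets_sample_space refl])
qed

lemma integral_restrict_sample:
  fixes h :: "(nat \<Rightarrow> 'a \<times> real) \<Rightarrow> real"
  assumes "k \<le> m" and [measurable]: "h \<in> borel_measurable (PiM {1..k} (\<lambda>_. P \<Otimes>\<^sub>M borel))"
  shows "(\<integral>w. h (restrict w {1..k}) \<partial>sample_space P \<sigma> m) = (\<integral>w. h w \<partial>sample_space P \<sigma> k)"
proof -
  have "(\<lambda>w. restrict w {1..k}) \<in> sample_space P \<sigma> m \<rightarrow>\<^sub>M sample_space P \<sigma> k"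
    using measurable_restrict_sample[OF assms(1)]
    by (simp add: measurable_cong_sets[OF sets_sample_space sets_sample_space])
  from integral_distr[OF this, of h] show ?thesis
    by (simp only: distr_sample_space_restrict[OF assms(1)] assms(2) measurable_cong_sets[OF sets_sample_space refl])
qed

text \<open>The argument lists covariates and noise rather than responses, so the moments of the
  error under \<open>f\<close> are integrals against the product measure itself.\<close>

definition residual ::
  "('a \<Rightarrow> real) \<Rightarrow> ((nat \<Rightarrow> 'a \<times> real) \<Rightarrow> 'a \<Rightarrow> real) \<Rightarrow> nat \<Rightarrow> (nat \<Rightarrow> 'a \<times> real) \<Rightarrow> real" where
  "residual f g i w = f (fst (w (Suc i))) - g (regression_data f i w) (fst (w (Suc i)))"

lemma residual_restrict: "residual f g i (restrict w {1..Suc i}) = residual f g i w"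
proof -
  have "regression_data f i (restrict w {1..Suc i}) = regression_data f i w"
    by (auto simp: regression_data_def fun_eq_iff)
  then show ?thesis by (simp add: residual_def)
qed

lemma residual_upd: "residual f g i (w(Suc i := z)) = f (fst z) - g (regression_data f i w) (fst z)"
proof -
  have "regression_data f i (w(Suc i := z)) = regression_data f i w"
    by (auto simp: regression_data_def fun_eq_iff)
  then show ?thesis by (simp add: residual_def)
qed

lemma measurable_residual [measurable]:
  assumes f [measurable]: "f \<in> borel_measurable P" and g: "is_estimator P i g" and "i < m"
  shows "residual f g i \<in> borel_measurable (PiM {1..m} (\<lambda>_. P \<Otimes>\<^sub>M borel))"
proof -
  have [measurable]: "Suc i \<in> {1..m}" and le: "i \<le> m" using assms by auto
  note [measurable] = measurable_regression_data[OF f le]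
  have "(\<lambda>w. (regression_data f i w, fst (w (Suc i)))) \<in> PiM {1..m} (\<lambda>_. P \<Otimes>\<^sub>M (borel :: real measure))
      \<rightarrow>\<^sub>M PiM {1..i} (\<lambda>_. P \<Otimes>\<^sub>M borel) \<Otimes>\<^sub>M P"
    by measurable
  from measurable_compose[OF this g[unfolded is_estimator_def]]
  have [measurable]: "(\<lambda>w. g (regression_data f i w) (fst (w (Suc i))))
      \<in> borel_measurable (PiM {1..m} (\<lambda>_. P \<Otimes>\<^sub>M borel))"
    by simp
  show ?thesis
    unfolding residual_def[abs_def] by measurable
qed

lemma measurable_estimator_section:
  assumes f: "f \<in> borel_measurable P" and g: "is_estimator P i g" and "w \<in> space (sample_space P \<sigma> i)"
  shows "g (regression_data f i w) \<in> borel_measurable P"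
proof -
  have "regression_data f i w \<in> space (PiM {1..i} (\<lambda>_. P \<Otimes>\<^sub>M (borel :: real measure)))"
    using measurable_space[OF measurable_regression_data[OF f order_refl]] assms(3)
    by (simp add: space_sample_space)
  from measurable_compose_Pair1[OF this g[unfolded is_estimator_def]] show ?thesis by simp
qed

text \<open>The covariate of observation \<open>Suc i\<close> is independent of the \<open>i\<close>
  observations used by the estimator, so averaging over it turns the squared error into the squared
  \<open>L2(P)\<close> norm inside the risk.\<close>

lemma nn_integral_residual_sq:
  assumes f [measurable]: "f \<in> borel_measurable P" and g [measurable]: "is_estimator P i g" and "i < m"
  shows "(\<integral>\<^sup>+ w. ennreal ((residual f g i w)\<^sup>2) \<partial>sample_space P \<sigma> m) = risk P \<sigma> i g f"
proof -
  note [measurable] = measurable_residual[OF f g lessI]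
  have meas: "(\<lambda>w. ennreal ((residual f g i w)\<^sup>2)) \<in> borel_measurable (PiM {1..Suc i} (\<lambda>_. P \<Otimes>\<^sub>M borel))"
    by measurable
  have "(\<integral>\<^sup>+ w. ennreal ((residual f g i w)\<^sup>2) \<partial>sample_space P \<sigma> m) =
      (\<integral>\<^sup>+ w. ennreal ((residual f g i w)\<^sup>2) \<partial>sample_space P \<sigma> (Suc i))"
    using nn_integral_restrict_sample[OF Suc_leI[OF \<open>i < m\<close>] meas] by (simp only: residual_restrict)
  also have "\<dots> = (\<integral>\<^sup>+ w. \<integral>\<^sup>+ z. ennreal ((f (fst z) - g (regression_data f i w) (fst z))\<^sup>2) \<partial>observation
      \<partial>sample_space P \<sigma> i)"
    by (subst nn_integral_sample_space_Suc) (auto simp: residual_upd)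
  also have "\<dots> = risk P \<sigma> i g f"
    unfolding risk_def
  proof (intro nn_integral_cong)
    fix w assume "w \<in> space (sample_space P \<sigma> i)"
    note [measurable] = measurable_estimator_section[OF f g this]
    show "(\<integral>\<^sup>+ z. ennreal ((f (fst z) - g (regression_data f i w) (fst z))\<^sup>2) \<partial>observation) =
        l2_norm_sq P (\<lambda>x. f x - g (regression_data f i w) x)"
      by (subst noise.nn_integral_fst[symmetric]) (auto simp: l2_norm_sq_def noise.emeasure_space_1[simplified])
  qed
  finally show ?thesis .
qed

lemma nn_integral_noise_sq_sample:
  assumes "i < m"
  shows "(\<integral>\<^sup>+ w. ennreal ((snd (w (Suc i)))\<^sup>2) \<partial>sample_space P \<sigma> m) < \<infinity>"
proof -
  have [measurable]: "Suc i \<in> {1..Suc i}" by simp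
  have meas: "(\<lambda>w. ennreal ((snd (w (Suc i)))\<^sup>2)) \<in> borel_measurable (PiM {1..Suc i} (\<lambda>_. P \<Otimes>\<^sub>M borel))"
    by measurable
  have "(\<integral>\<^sup>+ w. ennreal ((snd (w (Suc i)))\<^sup>2) \<partial>sample_space P \<sigma> m) =
      (\<integral>\<^sup>+ w. ennreal ((snd (w (Suc i)))\<^sup>2) \<partial>sample_space P \<sigma> (Suc i))"
    using nn_integral_restrict_sample[OF Suc_leI[OF \<open>i < m\<close>] meas] by simp
  also have "\<dots> = (\<integral>\<^sup>+ w. \<integral>\<^sup>+ z. ennreal ((snd z)\<^sup>2) \<partial>observation \<partial>sample_space P \<sigma> i)"
    by (subst nn_integral_sample_space_Suc) auto
  also have "\<dots> = (\<integral>\<^sup>+ z. ennreal ((snd z)\<^sup>2) \<partial>observation)"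
    using prob_space.emeasure_space_1[OF prob_space_sample_space, of i] by simp
  finally show ?thesis using nn_integral_noise_square by simp
qed

lemma integral_residual_sq:
  assumes f [measurable]: "f \<in> borel_measurable P" and g [measurable]: "is_estimator P i g" and "i < m"
    and "risk P \<sigma> i g f < \<infinity>"
  shows "integrable (sample_space P \<sigma> m) (\<lambda>w. (residual f g i w)\<^sup>2)"
    and "(\<integral>w. (residual f g i w)\<^sup>2 \<partial>sample_space P \<sigma> m) = enn2real (risk P \<sigma> i g f)"
proof -
  note [measurable] = measurable_residual[OF f g \<open>i < m\<close>]
  show "integrable (sample_space P \<sigma> m) (\<lambda>w. (residual f g i w)\<^sup>2)"
    using assms by (intro integrableI_nonneg) (auto simp: nn_integral_residual_sq)
  show "(\<integral>w. (residual f g i w)\<^sup>2 \<partial>sample_space P \<sigma> m) = enn2real (risk P \<sigma> i g f)"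
    using assms by (subst integral_eq_nn_integral) (auto simp: nn_integral_residual_sq)
qed

text \<open>The residual depends on the past and on the new covariate only, hence is independent of
  the new noise, which has mean 0. Finite risk and finite noise variance give integrability of the
  product.\<close>

lemma integral_noise_residual:
  assumes f [measurable]: "f \<in> borel_measurable P" and g [measurable]: "is_estimator P i g" and "i < m"
    and fin: "risk P \<sigma> i g f < \<infinity>"
  shows "integrable (sample_space P \<sigma> m) (\<lambda>w. snd (w (Suc i)) * residual f g i w)"
    and "(\<integral>w. snd (w (Suc i)) * residual f g i w \<partial>sample_space P \<sigma> m) = 0"
proof -
  \<comment> \<open>Integrability is used at two sample sizes: \<open>m\<close> for the claim and
    \<open>Suc i\<close> for Fubini.\<close>
  have int: "integrable (sample_space P \<sigma> n) (\<lambda>w. snd (w (Suc i)) * residual f g i w)" if "i < n" for n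
  proof -
    have [measurable]: "Suc i \<in> {1..n}" using that by simp
    note [measurable] = measurable_residual[OF f g that]
    have "integrable (sample_space P \<sigma> n) (\<lambda>w. (snd (w (Suc i)))\<^sup>2)"
      using nn_integral_noise_sq_sample[OF that] by (intro integrableI_nonneg) auto
    from Bochner_Integration.integrable_add[OF this integral_residual_sq(1)[OF f g that fin]]
    show ?thesis
    proof (rule Bochner_Integration.integrable_bound)
      have "\<bar>a * b\<bar> \<le> a\<^sup>2 + b\<^sup>2" for a b :: real
        using sum_squares_bound[of "\<bar>a\<bar>" "\<bar>b\<bar>"] mult_nonneg_nonneg[OF abs_ge_zero abs_ge_zero, of a b]
        unfolding abs_mult by (simp only: power2_abs mult.assoc)
      then show "AE w in sample_space P \<sigma> n. norm (snd (w (Suc i)) * residual f g i w)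
          \<le> norm ((snd (w (Suc i)))\<^sup>2 + (residual f g i w)\<^sup>2)"
        by (intro AE_I2) (simp add: order_trans[OF _ abs_ge_self])
    qed measurable
  qed
  then show "integrable (sample_space P \<sigma> m) (\<lambda>w. snd (w (Suc i)) * residual f g i w)"
    using \<open>i < m\<close> .
  have [measurable]: "Suc i \<in> {1..Suc i}" by simp
  note [measurable] = measurable_residual[OF f g lessI]
  have meas: "(\<lambda>w. snd (w (Suc i)) * residual f g i w) \<in> borel_measurable (PiM {1..Suc i} (\<lambda>_. P \<Otimes>\<^sub>M borel))"
    by measurable
  have "(\<integral>w. snd (w (Suc i)) * residual f g i w \<partial>sample_space P \<sigma> m) =
      (\<integral>w. snd (w (Suc i)) * residual f g i w \<partial>sample_space P \<sigma> (Suc i))"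
    using integral_restrict_sample[OF Suc_leI[OF \<open>i < m\<close>] meas] by (simp only: residual_restrict) simp
  also have "\<dots> = (\<integral>w. \<integral>z. snd z * (f (fst z) - g (regression_data f i w) (fst z)) \<partial>observation
      \<partial>sample_space P \<sigma> i)"
    by (subst integral_sample_space_Suc[OF int[OF lessI]]) (simp add: residual_upd)
  also have "\<dots> = (\<integral>w. 0 \<partial>sample_space P \<sigma> i)"
  proof (intro Bochner_Integration.integral_cong refl)
    fix w assume "w \<in> space (sample_space P \<sigma> i)"
    note [measurable] = measurable_estimator_section[OF f g this]
    show "(\<integral>z. snd z * (f (fst z) - g (regression_data f i w) (fst z)) \<partial>observation) = 0"
      by (rule integral_noise_mult) measurable
  qed
  finally show "(\<integral>w. snd (w (Suc i)) * residual f g i w \<partial>sample_space P \<sigma> m) = 0" by simp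
qed

section \<open>Relative entropy to the predictive law and change of measure\<close>

text \<open>
  The log-likelihood ratio of the data law of \<open>f\<close> to the predictive law, in terms of the noise
  and the prediction errors.
\<close>

definition log_ratio ::
  "('a \<Rightarrow> real) \<Rightarrow> (nat \<Rightarrow> (nat \<Rightarrow> 'a \<times> real) \<Rightarrow> 'a \<Rightarrow> real) \<Rightarrow> nat \<Rightarrow> (nat \<Rightarrow> 'a \<times> real) \<Rightarrow> real" where
  "log_ratio f g m w =
    (\<Sum>i<m. ((residual f (g i) i w)\<^sup>2 + 2 * (snd (w (Suc i)) * residual f (g i) i w)) / (2 * \<sigma>\<^sup>2))"

text \<open>This is the chain rule for relative entropy: the cross terms with the noise have mean 0,
  and each squared residual contributes the risk of one estimator.\<close>

lemma integral_log_ratio: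
  assumes f: "f \<in> borel_measurable P" and g: "\<And>i. i < m \<Longrightarrow> is_estimator P i (g i)"
    and fin: "\<And>i. i < m \<Longrightarrow> risk P \<sigma> i (g i) f < \<infinity>"
  shows "integrable (sample_space P \<sigma> m) (log_ratio f g m)"
    and "(\<integral>w. log_ratio f g m w \<partial>sample_space P \<sigma> m) =
      (\<Sum>i<m. enn2real (risk P \<sigma> i (g i) f)) / (2 * \<sigma>\<^sup>2)"
proof -
  let ?s = "\<lambda>i w. (residual f (g i) i w)\<^sup>2 + 2 * (snd (w (Suc i)) * residual f (g i) i w)"
  have int: "integrable (sample_space P \<sigma> m) (?s i)"
    and eq: "(\<integral>w. ?s i w \<partial>sample_space P \<sigma> m) = enn2real (risk P \<sigma> i (g i) f)" if "i < m" for i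
    using integral_residual_sq[OF f g[OF that] that fin[OF that]]
      integral_noise_residual[OF f g[OF that] that fin[OF that]] by simp_all
  show "integrable (sample_space P \<sigma> m) (log_ratio f g m)"
    unfolding log_ratio_def[abs_def] using int
    by (intro Bochner_Integration.integrable_sum Bochner_Integration.integrable_divide) simp
  have "(\<integral>w. log_ratio f g m w \<partial>sample_space P \<sigma> m) = (\<Sum>i<m. (\<integral>w. ?s i w / (2 * \<sigma>\<^sup>2) \<partial>sample_space P \<sigma> m))"
    unfolding log_ratio_def[abs_def] using int
    by (intro Bochner_Integration.integral_sum Bochner_Integration.integrable_divide) simp
  also have "\<dots> = (\<Sum>i<m. enn2real (risk P \<sigma> i (g i) f)) / (2 * \<sigma>\<^sup>2)"
    using eq by (simp only: sum_divide_distrib integral_divide_zero) simp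
  finally show "(\<integral>w. log_ratio f g m w \<partial>sample_space P \<sigma> m) =
      (\<Sum>i<m. enn2real (risk P \<sigma> i (g i) f)) / (2 * \<sigma>\<^sup>2)" .
qed

text \<open>Justifies reading \<open>log_ratio\<close> as a log-likelihood ratio: multiplying the
  density of the law of \<open>f\<close> by its inverse exponential gives the predictive density,
  factor by factor.\<close>

lemma exp_log_ratio:
  "exp (- log_ratio f g m w) *
    (\<Prod>i<m. tilt (f (fst (regression_data f m w (Suc i)))) (snd (regression_data f m w (Suc i)))) =
    predictive_density g m (regression_data f m w)"
proof -
  \<comment> \<open>Here \<open>a\<close> is the value of \<open>f\<close>, \<open>c\<close> the
    prediction and \<open>e\<close> the noise, so the response is \<open>a + e\<close>.\<close>
  have tilt_eq: "exp (- (((a - c)\<^sup>2 + 2 * (e * (a - c))) / (2 * \<sigma>\<^sup>2))) * tilt a (a + e) = tilt c (a + e)"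
    for a c e
  proof -
    have "(2 * (a + e) * a - a\<^sup>2) - ((a - c)\<^sup>2 + 2 * (e * (a - c))) = 2 * (a + e) * c - c\<^sup>2"
      by (simp add: power2_eq_square algebra_simps)
    then have "- (((a - c)\<^sup>2 + 2 * (e * (a - c))) / (2 * \<sigma>\<^sup>2)) + (2 * (a + e) * a - a\<^sup>2) / (2 * \<sigma>\<^sup>2) =
        (2 * (a + e) * c - c\<^sup>2) / (2 * \<sigma>\<^sup>2)"
      by (metis diff_divide_distrib uminus_add_conv_diff)
    then show ?thesis unfolding tilt_def mult_exp_exp by simp
  qed
  have "exp (- log_ratio f g m w) =
      (\<Prod>i<m. exp (- (((residual f (g i) i w)\<^sup>2 + 2 * (snd (w (Suc i)) * residual f (g i) i w)) / (2 * \<sigma>\<^sup>2))))"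
    unfolding log_ratio_def sum_negf[symmetric] by (rule exp_sum) simp
  then show ?thesis
    unfolding predictive_density_def
    by (simp only: prod.distrib[symmetric])
      (rule prod.cong, auto simp only: restrict_regression_data lessThan_iff less_imp_le,
        simp add: residual_def regression_data_def tilt_eq)
qed

lemma integral_predictive_density:
  assumes "\<And>i. i < m \<Longrightarrow> is_estimator P i (g i)"
  shows "integrable (sample_space P \<sigma> m) (predictive_density g m)"
    and "(\<integral>d. predictive_density g m d \<partial>sample_space P \<sigma> m) = 1"
proof -
  note [measurable] = measurable_predictive_density[OF assms]
  show "integrable (sample_space P \<sigma> m) (predictive_density g m)"
    using assms
    by (intro integrableI_nonneg) (auto simp: nn_integral_predictive_density predictive_density_nonneg)
  show "(\<integral>d. predictive_density g m d \<partial>sample_space P \<sigma> m) = 1"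
    using assms
    by (subst integral_eq_nn_integral) (auto simp: nn_integral_predictive_density predictive_density_nonneg)
qed

lemma integrable_exp_predictive_density:
  assumes g: "\<And>i. i < m \<Longrightarrow> is_estimator P i (g i)"
    and G [measurable]: "G \<in> borel_measurable (PiM {1..m} (\<lambda>_. P \<Otimes>\<^sub>M borel))"
    and le: "\<And>d. G d \<le> b"
  shows "integrable (sample_space P \<sigma> m) (\<lambda>d. exp (G d) * predictive_density g m d)"
proof (rule Bochner_Integration.integrable_bound)
  note [measurable] = measurable_predictive_density[OF g]
  show "integrable (sample_space P \<sigma> m) (\<lambda>d. exp b * predictive_density g m d)"
    using integral_predictive_density(1)[OF g] by simp
  show "(\<lambda>d. exp (G d) * predictive_density g m d) \<in> borel_measurable (sample_space P \<sigma> m)"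
    by measurable
  show "AE d in sample_space P \<sigma> m. norm (exp (G d) * predictive_density g m d)
      \<le> norm (exp b * predictive_density g m d)"
    using le by (intro AE_I2) (simp add: abs_mult mult_right_mono)
qed

text \<open>
  A linearised form of the Donsker-Varadhan inequality, obtained by integrating \<open>1 + u \<le> exp u\<close>
  for \<open>u = G - log_ratio - ln 2\<close>.
\<close>

lemma change_of_measure:
  assumes f: "f \<in> borel_measurable P" and g: "\<And>i. i < m \<Longrightarrow> is_estimator P i (g i)"
    and fin: "\<And>i. i < m \<Longrightarrow> risk P \<sigma> i (g i) f < \<infinity>"
    and G [measurable]: "G \<in> borel_measurable (PiM {1..m} (\<lambda>_. P \<Otimes>\<^sub>M borel))"
    and G_nonneg: "\<And>d. 0 \<le> G d" and G_le: "\<And>d. G d \<le> b"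
  shows "(\<integral>w. G (regression_data f m w) \<partial>sample_space P \<sigma> m) \<le>
    (\<Sum>i<m. enn2real (risk P \<sigma> i (g i) f)) / (2 * \<sigma>\<^sup>2) + ln 2 +
    (\<integral>d. exp (G d) * predictive_density g m d \<partial>sample_space P \<sigma> m) / 2 - 1"
proof -
  interpret S: prob_space "sample_space P \<sigma> m" by (rule prob_space_sample_space)
  note [measurable] = f measurable_predictive_density[OF g] measurable_regression_data[OF f order_refl]
  define p where "p d = (\<Prod>i<m. tilt (f (fst (d (Suc i)))) (snd (d (Suc i))))" for d :: "nat \<Rightarrow> 'a \<times> real"
  have p_pos: "0 < p d" for d
    by (simp add: p_def prod_pos)
  have [measurable]: "p \<in> borel_measurable (PiM {1..m} (\<lambda>_. P \<Otimes>\<^sub>M borel))"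
    unfolding p_def[abs_def]
  proof (intro borel_measurable_prod)
    fix i assume "i \<in> {..<m}"
    then have [measurable]: "Suc i \<in> {1..m}" by auto
    show "(\<lambda>d. tilt (f (fst (d (Suc i)))) (snd (d (Suc i)))) \<in> borel_measurable (PiM {1..m} (\<lambda>_. P \<Otimes>\<^sub>M borel))"
      by measurable
  qed
  note L = integral_log_ratio[OF f g fin]
  note [measurable] = borel_measurable_integrable[OF L(1)]
  \<comment> \<open>The inverse likelihood ratio weighted by \<open>exp G\<close>. Its expectation
    under the law of \<open>f\<close> equals that of \<open>exp G\<close> under the predictive law,
    because the density \<open>p\<close> cancels.\<close>
  define U where "U w = exp (G (regression_data f m w)) * exp (- log_ratio f g m w)" for w
  have U_eq: "U w = exp (G (regression_data f m w)) * predictive_density g m (regression_data f m w) /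
      p (regression_data f m w)" for w
    using exp_log_ratio[of f g m w] p_pos[of "regression_data f m w"]
    by (simp add: U_def field_simps flip: p_def)
  have U_meas [measurable]: "U \<in> borel_measurable (sample_space P \<sigma> m)"
    unfolding U_def[abs_def] by measurable
  have meas: "(\<lambda>d. ennreal (exp (G d) * predictive_density g m d / p d))
      \<in> borel_measurable (PiM {1..m} (\<lambda>_. P \<Otimes>\<^sub>M borel))"
    by measurable
  have "(\<integral>\<^sup>+ w. ennreal (U w) \<partial>sample_space P \<sigma> m) =
      (\<integral>\<^sup>+ d. ennreal (exp (G d) * predictive_density g m d / p d) * ennreal (p d) \<partial>sample_space P \<sigma> m)"
    unfolding U_eq using nn_integral_regression_data[OF f meas] by (simp flip: p_def)
  also have "\<dots> = (\<integral>\<^sup>+ d. ennreal (exp (G d) * predictive_density g m d) \<partial>sample_space P \<sigma> m)"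
    using p_pos predictive_density_nonneg
    by (intro nn_integral_cong) (simp flip: ennreal_mult add: less_imp_le less_imp_neq[symmetric])
  finally have nn: "(\<integral>\<^sup>+ w. ennreal (U w) \<partial>sample_space P \<sigma> m) =
      (\<integral>\<^sup>+ d. ennreal (exp (G d) * predictive_density g m d) \<partial>sample_space P \<sigma> m)" .
  have U_nonneg: "0 \<le> U w" for w
    by (simp add: U_def)
  note int = integrable_exp_predictive_density[OF g G G_le]
  have U_int: "integrable (sample_space P \<sigma> m) U"
    using int U_nonneg predictive_density_nonneg
    by (intro integrableI_nonneg) (auto simp: nn integrable_iff_bounded)
  have U_integral: "(\<integral>w. U w \<partial>sample_space P \<sigma> m) =
      (\<integral>d. exp (G d) * predictive_density g m d \<partial>sample_space P \<sigma> m)"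
    using U_nonneg predictive_density_nonneg
    by (subst (1 2) integral_eq_nn_integral) (auto simp: nn)
  have G_int: "integrable (sample_space P \<sigma> m) (\<lambda>w. G (regression_data f m w))"
    using G_nonneg G_le by (intro S.integrable_const_bound[where B=b]) auto
  have "(\<integral>w. G (regression_data f m w) \<partial>sample_space P \<sigma> m) \<le>
      (\<integral>w. log_ratio f g m w + ln 2 + U w / 2 - 1 \<partial>sample_space P \<sigma> m)"
  proof (rule integral_mono)
    fix w
    have "U w / 2 = exp (G (regression_data f m w) - log_ratio f g m w - ln 2)"
      by (simp add: U_def exp_diff exp_minus exp_add field_simps)
    then show "G (regression_data f m w) \<le> log_ratio f g m w + ln 2 + U w / 2 - 1"
      using exp_ge_add_one_self[of "G (regression_data f m w) - log_ratio f g m w - ln 2"] by linarith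
  qed (use G_int L(1) U_int in simp_all)
  also have "\<dots> = (\<Sum>i<m. enn2real (risk P \<sigma> i (g i) f)) / (2 * \<sigma>\<^sup>2) + ln 2 +
      (\<integral>d. exp (G d) * predictive_density g m d \<partial>sample_space P \<sigma> m) / 2 - 1"
    using L U_int by (simp add: U_integral S.prob_space)
  finally show ?thesis .
qed

section \<open>The sequential Fano inequality and decoding from the last estimator\<close>

text \<open>Change of measure is applied to the function equal to \<open>ln N\<close> on the
  decoding set of \<open>f\<close> and 0 elsewhere, whose mean under \<open>f\<close> is at least
  \<open>q * ln N\<close>. The predictive law is the same for all \<open>f\<close>, and the decoding
  sets are disjoint, so the exponentials sum over \<open>S\<close> to at most
  \<open>N + (N - 1)\<close> pointwise.\<close>

lemma fano_sequential:
  assumes S: "finite S" "S \<noteq> {}" "\<And>f. f \<in> S \<Longrightarrow> f \<in> borel_measurable P"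
    and g: "\<And>i. i < m \<Longrightarrow> is_estimator P i (g i)"
    and fin: "\<And>f i. f \<in> S \<Longrightarrow> i < m \<Longrightarrow> risk P \<sigma> i (g i) f < \<infinity>"
    and K: "\<And>f. f \<in> S \<Longrightarrow> (\<Sum>i<m. enn2real (risk P \<sigma> i (g i) f)) \<le> K"
    and A: "\<And>f. f \<in> S \<Longrightarrow> A f \<in> sets (PiM {1..m} (\<lambda>_. P \<Otimes>\<^sub>M borel))"
    and disj: "disjoint_family_on A S"
    and success: "\<And>f. f \<in> S \<Longrightarrow> q \<le> (\<integral>w. indicator (A f) (regression_data f m w) \<partial>sample_space P \<sigma> m)"
  shows "q * ln (real (card S)) \<le> K / (2 * \<sigma>\<^sup>2) + ln 2"
proof -
  define N where "N = real (card S)"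
  define G where "G f d = ln N * indicator (A f) d" for f d
  have N: "1 \<le> N"
    using S(1,2) by (simp add: N_def Suc_leI card_gt_0_iff)
  have exp_G: "exp (G f d) = 1 + (N - 1) * indicator (A f) d" for f d
    using N by (simp add: G_def indicator_def)
  have G_meas: "G f \<in> borel_measurable (PiM {1..m} (\<lambda>_. P \<Otimes>\<^sub>M borel))" if "f \<in> S" for f
    unfolding G_def[abs_def] using A[OF that] by measurable
  have G_bounds: "0 \<le> G f d" "G f d \<le> ln N" for f d
    using N by (auto simp: G_def indicator_def)
  have int: "integrable (sample_space P \<sigma> m) (\<lambda>d. exp (G f d) * predictive_density g m d)" if "f \<in> S" for f
    using integrable_exp_predictive_density[OF g G_meas[OF that] G_bounds(2)] .
  have "(\<Sum>f\<in>S. \<integral>d. exp (G f d) * predictive_density g m d \<partial>sample_space P \<sigma> m) =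
      (\<integral>d. (\<Sum>f\<in>S. exp (G f d) * predictive_density g m d) \<partial>sample_space P \<sigma> m)"
    using int by (rule Bochner_Integration.integral_sum[symmetric])
  also have "\<dots> \<le> (\<integral>d. 2 * N * predictive_density g m d \<partial>sample_space P \<sigma> m)"
  proof (rule integral_mono)
    fix d
    have "(\<Sum>f\<in>S. indicator (A f) d :: real) \<le> 1"
    proof (cases "\<exists>f\<in>S. d \<in> A f")
      case True
      then obtain f where "f \<in> S" "d \<in> A f" by auto
      have "(\<Sum>f'\<in>S. indicator (A f') d :: real) = (\<Sum>f'\<in>S. if f' = f then 1 else 0)"
        using disj \<open>f \<in> S\<close> \<open>d \<in> A f\<close>
        by (intro sum.cong refl) (auto simp: disjoint_family_on_def indicator_def)
      then show ?thesis
        using S(1) by simp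
    qed (simp add: indicator_def)
    then have "(N - 1) * (\<Sum>f\<in>S. indicator (A f) d) \<le> (N - 1) * 1"
      using N by (intro mult_left_mono) auto
    then have "(\<Sum>f\<in>S. exp (G f d)) \<le> 2 * N"
      by (simp add: exp_G sum.distrib sum_distrib_left[symmetric] flip: N_def)
    then show "(\<Sum>f\<in>S. exp (G f d) * predictive_density g m d) \<le> 2 * N * predictive_density g m d"
      unfolding sum_distrib_right[symmetric] by (intro mult_right_mono predictive_density_nonneg)
  qed (use int integral_predictive_density(1)[OF g] in simp_all)
  also have "\<dots> = 2 * N"
    using integral_predictive_density[OF g] by simp
  finally have sum_le: "(\<Sum>f\<in>S. \<integral>d. exp (G f d) * predictive_density g m d \<partial>sample_space P \<sigma> m) \<le> 2 * N" .
  have "(\<Sum>f\<in>S. q * ln N) \<le> (\<Sum>f\<in>S. K / (2 * \<sigma>\<^sup>2) + ln 2 - 1 +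
      (\<integral>d. exp (G f d) * predictive_density g m d \<partial>sample_space P \<sigma> m) / 2)"
  proof (rule sum_mono)
    fix f assume f: "f \<in> S"
    have "q * ln N \<le> (\<integral>w. G f (regression_data f m w) \<partial>sample_space P \<sigma> m)"
      using mult_left_mono[OF success[OF f], of "ln N"] N by (simp add: G_def mult.commute)
    also have "\<dots> \<le> (\<Sum>i<m. enn2real (risk P \<sigma> i (g i) f)) / (2 * \<sigma>\<^sup>2) + ln 2 +
        (\<integral>d. exp (G f d) * predictive_density g m d \<partial>sample_space P \<sigma> m) / 2 - 1"
      using change_of_measure[OF S(3)[OF f] g fin[OF f] G_meas[OF f] G_bounds] .
    finally show "q * ln N \<le> K / (2 * \<sigma>\<^sup>2) + ln 2 - 1 +
        (\<integral>d. exp (G f d) * predictive_density g m d \<partial>sample_space P \<sigma> m) / 2"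
      using divide_right_mono[OF K[OF f], of "2 * \<sigma>\<^sup>2"] by simp
  qed
  also have "\<dots> = N * (K / (2 * \<sigma>\<^sup>2) + ln 2 - 1) +
      (\<Sum>f\<in>S. \<integral>d. exp (G f d) * predictive_density g m d \<partial>sample_space P \<sigma> m) / 2"
    by (simp only: sum.distrib sum_divide_distrib sum_constant N_def)
  \<comment> \<open>The exponential integrals average to at most 2, so their halves cancel the
    \<open>- 1\<close>. The \<open>ln 2\<close> in \<open>change_of_measure\<close> was chosen for
    this.\<close>
  also have "\<dots> \<le> N * (K / (2 * \<sigma>\<^sup>2) + ln 2)"
    using sum_le by (simp add: algebra_simps)
  finally show ?thesis
    using N by (simp flip: N_def)
qed

text \<open>A squared triangle inequality, obtained by integrating
  \<open>(u - v)^2 \<le> 2 u^2 + 2 v^2\<close> with \<open>u = f - h\<close> and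
  \<open>v = f' - h\<close>.\<close>

lemma l2_norm_sq_diff_le:
  assumes [measurable]: "f \<in> borel_measurable P" "f' \<in> borel_measurable P" "h \<in> borel_measurable P"
    and "0 \<le> a" "l2_norm_sq P (\<lambda>x. f x - h x) \<le> ennreal a" "l2_norm_sq P (\<lambda>x. f' x - h x) \<le> ennreal a"
  shows "l2_norm_sq P (\<lambda>x. f x - f' x) \<le> ennreal (4 * a)"
proof -
  have "l2_norm_sq P (\<lambda>x. f x - f' x) \<le>
      (\<integral>\<^sup>+ x. 2 * ennreal ((f x - h x)\<^sup>2) + 2 * ennreal ((f' x - h x)\<^sup>2) \<partial>P)"
    unfolding l2_norm_sq_def
  proof (intro nn_integral_mono)
    fix x
    have "(f x - f' x)\<^sup>2 \<le> 2 * (f x - h x)\<^sup>2 + 2 * (f' x - h x)\<^sup>2"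
      using zero_le_power2[of "(f x - h x) + (f' x - h x)"] by (simp add: power2_eq_square algebra_simps)
    then have "ennreal ((f x - f' x)\<^sup>2) \<le> ennreal (2 * (f x - h x)\<^sup>2 + 2 * (f' x - h x)\<^sup>2)"
      by (rule ennreal_leI)
    then show "ennreal ((f x - f' x)\<^sup>2) \<le> 2 * ennreal ((f x - h x)\<^sup>2) + 2 * ennreal ((f' x - h x)\<^sup>2)"
      by (simp add: ennreal_plus ennreal_mult)
  qed
  also have "\<dots> = 2 * l2_norm_sq P (\<lambda>x. f x - h x) + 2 * l2_norm_sq P (\<lambda>x. f' x - h x)"
    unfolding l2_norm_sq_def by (simp add: nn_integral_add nn_integral_cmult)
  also have "\<dots> \<le> 2 * ennreal a + 2 * ennreal a"
    using assms by (intro add_mono mult_left_mono) auto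
  also have "\<dots> = ennreal (4 * a)"
    using \<open>0 \<le> a\<close> by (simp add: ennreal_mult flip: distrib_right)
  finally show ?thesis .
qed

text \<open>Estimators \<open>0\<close>, ..., \<open>m - 1\<close> define the predictive law, and
  estimator \<open>m\<close> decodes. Decoding succeeds when it lies within \<epsilon>/2 of the true
  function.\<close>

lemma packing_bound_fixed_sample:
  assumes S: "finite S" "S \<noteq> {}" "\<And>f. f \<in> S \<Longrightarrow> f \<in> borel_measurable P"
    and sep: "\<And>f f'. f \<in> S \<Longrightarrow> f' \<in> S \<Longrightarrow> f \<noteq> f' \<Longrightarrow> l2_dist P f f' > \<epsilon>" and "0 < \<epsilon>"
    and g: "\<And>i. i \<le> m \<Longrightarrow> is_estimator P i (g i)"
    and r: "\<And>f i. f \<in> S \<Longrightarrow> i \<le> m \<Longrightarrow> risk P \<sigma> i (g i) f \<le> ennreal (r i)" "\<And>i. 0 \<le> r i"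
  shows "(1 - 4 * r m / \<epsilon>\<^sup>2) * ln (real (card S)) \<le> (\<Sum>i<m. r i) / (2 * \<sigma>\<^sup>2) + ln 2"
proof -
  interpret S: prob_space "sample_space P \<sigma> m" by (rule prob_space_sample_space)
  \<comment> \<open>The threshold is the square of half the separation, so a point common to two of
    these sets would put two members of the packing within distance \<epsilon>.\<close>
  define A where "A f = {d \<in> space (PiM {1..m} (\<lambda>_. P \<Otimes>\<^sub>M (borel :: real measure))).
    l2_norm_sq P (\<lambda>x. f x - g m d x) \<le> ennreal (\<epsilon>\<^sup>2 / 4)}" for f
  have norm_meas: "(\<lambda>d. l2_norm_sq P (\<lambda>x. f x - g m d x)) \<in> borel_measurable (PiM {1..m} (\<lambda>_. P \<Otimes>\<^sub>M borel))"
    if "f \<in> S" for f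
  proof -
    have [measurable]: "f \<in> borel_measurable P" by (rule S(3)[OF that])
    have [measurable]: "(\<lambda>(d, x). g m d x) \<in> borel_measurable (PiM {1..m} (\<lambda>_. P \<Otimes>\<^sub>M borel) \<Otimes>\<^sub>M P)"
      using g[OF order_refl] by (simp add: is_estimator_def)
    show ?thesis unfolding l2_norm_sq_def by measurable
  qed
  have A_sets: "A f \<in> sets (PiM {1..m} (\<lambda>_. P \<Otimes>\<^sub>M borel))" if "f \<in> S" for f
    unfolding A_def using norm_meas[OF that] by measurable
  have "disjoint_family_on A S"
    unfolding disjoint_family_on_def
  proof (intro ballI impI, rule ccontr)
    fix f f' assume ff: "f \<in> S" "f' \<in> S" "f \<noteq> f'" and "A f \<inter> A f' \<noteq> {}"
    then obtain d where d: "d \<in> space (PiM {1..m} (\<lambda>_. P \<Otimes>\<^sub>M (borel :: real measure)))"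
      "l2_norm_sq P (\<lambda>x. f x - g m d x) \<le> ennreal (\<epsilon>\<^sup>2 / 4)"
      "l2_norm_sq P (\<lambda>x. f' x - g m d x) \<le> ennreal (\<epsilon>\<^sup>2 / 4)"
      by (auto simp: A_def)
    have "g m d \<in> borel_measurable P"
      using measurable_compose_Pair1[OF d(1) g[OF order_refl, unfolded is_estimator_def]] by simp
    from l2_norm_sq_diff_le[OF S(3)[OF ff(1)] S(3)[OF ff(2)] this _ d(2,3)]
    have "l2_norm_sq P (\<lambda>x. f x - f' x) \<le> ennreal (\<epsilon>\<^sup>2)" by simp
    then have "enn2real (l2_norm_sq P (\<lambda>x. f x - f' x)) \<le> \<epsilon>\<^sup>2"
      by (simp add: enn2real_leI)
    then have "l2_dist P f f' \<le> \<epsilon>"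
      using \<open>0 < \<epsilon>\<close> by (simp add: l2_dist_def real_le_lsqrt)
    with sep[OF ff] show False by simp
  qed
  moreover have "1 - 4 * r m / \<epsilon>\<^sup>2 \<le> (\<integral>w. indicator (A f) (regression_data f m w) \<partial>sample_space P \<sigma> m)"
    if f: "f \<in> S" for f
  proof -
    note [measurable] = A_sets[OF f] S(3)[OF f] measurable_regression_data[OF S(3)[OF f] order_refl]
    let ?I = "\<lambda>w. indicator (A f) (regression_data f m w) :: real"
    have I_int: "integrable (sample_space P \<sigma> m) ?I"
      by (intro S.integrable_const_bound[where B=1]) (auto simp: indicator_def)
    \<comment> \<open>Markov's inequality: whenever decoding fails, the squared error exceeds the
      threshold.\<close>
    have "ennreal (\<epsilon>\<^sup>2 / 4 * (\<integral>w. 1 - ?I w \<partial>sample_space P \<sigma> m)) =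
        (\<integral>\<^sup>+ w. ennreal (\<epsilon>\<^sup>2 / 4 * (1 - ?I w)) \<partial>sample_space P \<sigma> m)"
      using I_int by (subst nn_integral_eq_integral) (auto simp: indicator_def)
    also have "\<dots> \<le> risk P \<sigma> m (g m) f"
      unfolding risk_def
    proof (intro nn_integral_mono)
      fix w assume "w \<in> space (sample_space P \<sigma> m)"
      then have "regression_data f m w \<in> space (PiM {1..m} (\<lambda>_. P \<Otimes>\<^sub>M (borel :: real measure)))"
        using measurable_space[OF measurable_regression_data[OF S(3)[OF f] order_refl]]
        by (simp add: space_sample_space)
      then show "ennreal (\<epsilon>\<^sup>2 / 4 * (1 - ?I w)) \<le> l2_norm_sq P (\<lambda>x. f x - g m (regression_data f m w) x)"
        by (auto simp: A_def indicator_def)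
    qed
    also have "\<dots> \<le> ennreal (r m)"
      by (rule r(1)[OF f order_refl])
    finally have "\<epsilon>\<^sup>2 / 4 * (\<integral>w. 1 - ?I w \<partial>sample_space P \<sigma> m) \<le> r m"
      by (simp add: r(2))
    then have "\<epsilon>\<^sup>2 / 4 * (1 - (\<integral>w. ?I w \<partial>sample_space P \<sigma> m)) \<le> r m"
      using I_int by (simp add: S.prob_space)
    then show ?thesis
      using \<open>0 < \<epsilon>\<close> by (simp add: field_simps)
  qed
  moreover have "(\<Sum>i<m. enn2real (risk P \<sigma> i (g i) f)) \<le> (\<Sum>i<m. r i)" if "f \<in> S" for f
    using r(1)[OF that] r(2) by (intro sum_mono enn2real_leI) auto
  moreover have "risk P \<sigma> i (g i) f < \<infinity>" if "f \<in> S" "i < m" for f i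
    using r(1)[OF that(1), of i] that(2) by (auto intro: le_less_trans)
  ultimately show ?thesis
    using fano_sequential[OF S, of m g "\<Sum>i<m. r i" A "1 - 4 * r m / \<epsilon>\<^sup>2"] g A_sets by simp
qed

end


section \<open>Growing noise level and the limit of large samples\<close>

text \<open>For \<open>i \<ge> 1\<close> the term is at most
  \<open>2 * sqrt i - 2 * sqrt (i - 1)\<close>, by the arithmetic-geometric mean inequality, and
  these bounds telescope. The extra 1 is the term of index 0.\<close>

lemma sum_inverse_sqrt_le:
  "(\<Sum>i<Suc n. 1 / sqrt (real (max i 1))) \<le> 1 + 2 * sqrt (real n)"
proof (induction n)
  case (Suc n)
  let ?a = "sqrt (real n)" and ?b = "sqrt (real (Suc n))"
  have "?b > 0" "?a \<ge> 0" by simp_all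
  have "?a * ?b \<le> (?a\<^sup>2 + ?b\<^sup>2) / 2"
    using sum_squares_bound[of ?a ?b] by simp
  also have "\<dots> = ?b\<^sup>2 - 1 / 2"
    by (simp add: field_simps)
  finally have "1 / ?b \<le> 2 * ?b - 2 * ?a"
    using \<open>?b > 0\<close> by (simp only: divide_le_eq) (simp add: power2_eq_square algebra_simps)
  with Suc.IH show ?case by simp
qed simp

text \<open>For a fixed packing the sample size is \<open>Suc n\<close> and \<sigma> is its square
  root divided by \<tau>. Both sides of the resulting inequality are then continuous in
  \<open>y n\<close>, the inverse square root of the sample size, and the claim is their limit as
  \<open>y n\<close> tends to 0.\<close>

lemma ln_packing_bound:
  fixes P :: "'a measure" and F :: "('a \<Rightarrow> real) set" and B C \<epsilon> \<tau> :: real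
  assumes P: "prob_space P" and "0 < B"
    and F: "\<And>f. f \<in> F \<Longrightarrow> f \<in> borel_measurable P"
    and "0 \<le> C"
    and est: "\<And>(\<sigma>::real) (m::nat). \<sigma> > 0 \<Longrightarrow>
           \<exists>fhat. is_estimator P m fhat \<and>
             (SUP f\<in>F. risk P \<sigma> m fhat f) \<le> ennreal ((B + \<sigma>) * (C / sqrt (real (max m 1))))"
    and S: "is_packing P \<epsilon> F S" "finite S" "S \<noteq> {}"
    and pos: "0 < \<epsilon>" "0 < \<tau>"
  shows "(1 - 4 * C / (\<tau> * \<epsilon>\<^sup>2)) * ln (real (card S)) \<le> C * \<tau> + ln 2"
proof -
  define y where "y n = 1 / sqrt (real (Suc n))" for n
  have y_pos: "0 < y n" for n by (simp add: y_def)
  have lim_y: "y \<longlonglongrightarrow> 0"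
    unfolding y_def by real_asymp
  let ?L = "ln (real (card S))"
  have "(1 - 4 * (C * (B * y n + 1 / \<tau>)) / \<epsilon>\<^sup>2) * ?L \<le>
      C * \<tau>\<^sup>2 * (B * y n + 1 / \<tau>) * (y n + 2) / 2 + ln 2" for n
  proof -
    define s where "s = sqrt (real (Suc n))"
    define \<sigma> where "\<sigma> = s / \<tau>"
    have s: "0 < s" "y n = 1 / s" by (simp_all add: s_def y_def)
    have \<sigma>: "0 < \<sigma>" using s pos by (simp add: \<sigma>_def)
    define r where "r m = (B + \<sigma>) * (C / sqrt (real (max m 1)))" for m
    interpret gaussian_regression P \<sigma>
      using P \<sigma> by (simp add: gaussian_regression_def gaussian_regression_axioms_def)
    \<comment> \<open>One estimator for every sample size, all at the single noise level determined
      by \<open>n\<close>.\<close>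
    obtain g where g: "\<And>m. is_estimator P m (g m)" "\<And>m. (SUP f\<in>F. risk P \<sigma> m (g m) f) \<le> ennreal (r m)"
      using est[OF \<sigma>] unfolding r_def by metis
    have fano: "(1 - 4 * r (Suc n) / \<epsilon>\<^sup>2) * ?L \<le> (\<Sum>i<Suc n. r i) / (2 * \<sigma>\<^sup>2) + ln 2"
    proof (rule packing_bound_fixed_sample)
      show "risk P \<sigma> i (g i) f \<le> ennreal (r i)" if "f \<in> S" for f i
        using g(2)[of i] that S(1) by (auto simp: SUP_le_iff is_packing_def)
      show "0 \<le> r i" for i
        using \<open>0 < B\<close> \<sigma> \<open>0 \<le> C\<close> by (simp add: r_def)
    qed (use S F g(1) pos in \<open>auto simp: is_packing_def\<close>)
    have risk: "r (Suc n) = C * (B * y n + 1 / \<tau>)"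
    proof -
      have "sqrt (real (max (Suc n) 1)) = s" by (simp add: s_def)
      then show ?thesis
        using s(1) pos unfolding r_def \<sigma>_def s(2) by (simp add: field_simps)
    qed
    have "(\<Sum>i<Suc n. r i) / (2 * \<sigma>\<^sup>2) \<le> C * \<tau>\<^sup>2 * (B * y n + 1 / \<tau>) * (y n + 2) / 2"
    proof -
      have "(\<Sum>i<Suc n. r i) = (B + \<sigma>) * C * (\<Sum>i<Suc n. 1 / sqrt (real (max i 1)))"
        unfolding r_def sum_distrib_left by (intro sum.cong) simp_all
      \<comment> \<open>Enlarging \<open>sqrt n\<close> to \<open>s = sqrt (Suc n)\<close> leaves an
        expression that depends on \<open>n\<close> through \<open>s\<close> alone.\<close>
      also have "\<dots> \<le> (B + \<sigma>) * C * (1 + 2 * s)"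
        using order_trans[OF sum_inverse_sqrt_le, of n "1 + 2 * s"] \<open>0 < B\<close> \<sigma> \<open>0 \<le> C\<close>
        by (intro mult_left_mono) (simp_all add: s_def)
      finally have "(\<Sum>i<Suc n. r i) / (2 * \<sigma>\<^sup>2) \<le> (B + \<sigma>) * C * (1 + 2 * s) / (2 * \<sigma>\<^sup>2)"
        using \<sigma> by (intro divide_right_mono) simp_all
      also have "\<dots> = C * \<tau>\<^sup>2 * (B * y n + 1 / \<tau>) * (y n + 2) / 2"
        using s(1) pos unfolding \<sigma>_def s(2) by (simp add: field_simps power2_eq_square)
      finally show ?thesis .
    qed
    from order_trans[OF fano[unfolded risk] add_right_mono[OF this]] show ?thesis .
  qed
  moreover have "(\<lambda>n. (1 - 4 * (C * (B * y n + 1 / \<tau>)) / \<epsilon>\<^sup>2) * ?L)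
      \<longlonglongrightarrow> (1 - 4 * (C * (B * 0 + 1 / \<tau>)) / \<epsilon>\<^sup>2) * ?L"
    using pos by (intro tendsto_intros lim_y) simp_all
  moreover have "(\<lambda>n. C * \<tau>\<^sup>2 * (B * y n + 1 / \<tau>) * (y n + 2) / 2 + ln 2)
      \<longlonglongrightarrow> C * \<tau>\<^sup>2 * (B * 0 + 1 / \<tau>) * (0 + 2) / 2 + ln 2"
    by (intro tendsto_intros lim_y) simp_all
  ultimately have "(1 - 4 * (C * (B * 0 + 1 / \<tau>)) / \<epsilon>\<^sup>2) * ?L \<le>
      C * \<tau>\<^sup>2 * (B * 0 + 1 / \<tau>) * (0 + 2) / 2 + ln 2"
    by (intro LIMSEQ_le) auto
  then show ?thesis
    using pos by (simp add: power2_eq_square)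
qed

section \<open>From finite packings to the packing number\<close>

text \<open>Subsets of packings are packings, so an infinite packing would contain finite ones of
  every size; a bound on finite packings thus bounds the supremum.\<close>

lemma packing_number_bound:
  assumes "\<And>S. is_packing P \<epsilon> F S \<Longrightarrow> finite S \<Longrightarrow> real (card S) \<le> K"
  shows "packing_number P \<epsilon> F \<noteq> \<infinity> \<and> real (the_enat (packing_number P \<epsilon> F)) \<le> K"
proof -
  \<comment> \<open>The empty packing makes \<open>K\<close> nonnegative, so that \<open>nat\<close>
    of its floor does not exceed \<open>K\<close>.\<close>
  have K: "0 \<le> K"
    using assms[of "{}"] by (simp add: is_packing_def)
  have fin: "finite S" if S: "is_packing P \<epsilon> F S" for S
  proof (rule ccontr)
    assume "infinite S"
    then obtain T where T: "T \<subseteq> S" "finite T" "card T = Suc (nat \<lfloor>K\<rfloor>)"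
      using infinite_arbitrarily_large by blast
    then have "is_packing P \<epsilon> F T"
      using S by (auto simp: is_packing_def)
    from assms[OF this T(2)] T(3) show False by linarith
  qed
  have "packing_number P \<epsilon> F \<le> enat (nat \<lfloor>K\<rfloor>)"
    unfolding packing_number_def
  proof (rule SUP_least)
    fix S assume "S \<in> {S. is_packing P \<epsilon> F S}"
    then show "(if finite S then enat (card S) else \<infinity>) \<le> enat (nat \<lfloor>K\<rfloor>)"
      using assms[of S] fin[of S] by (simp add: le_nat_floor)
  qed
  then obtain k where "packing_number P \<epsilon> F = enat k" "k \<le> nat \<lfloor>K\<rfloor>"
    by (cases "packing_number P \<epsilon> F") auto
  moreover from this(2) K have "real k \<le> K" by linarith
  ultimately show ?thesis by simp
qed

theorem corollary3:
  fixes P :: "'a measure" and F :: "('a \<Rightarrow> real) set" and B C :: real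
  assumes "prob_space P"
    and "B > 0"
    and "F \<noteq> {}"
    and "\<And>f. f \<in> F \<Longrightarrow> f \<in> borel_measurable P"
    and "\<And>f x. f \<in> F \<Longrightarrow> x \<in> space P \<Longrightarrow> f x \<in> {-B..B}"
    and "C \<ge> 0"
    and "\<And>(\<sigma>::real) (m::nat). \<sigma> > 0 \<Longrightarrow>
           \<exists>fhat. is_estimator P m fhat \<and>
             (SUP f\<in>F. risk P \<sigma> m fhat f) \<le> ennreal ((B + \<sigma>) * (C / sqrt (real (max m 1))))"
  shows "\<forall>\<epsilon>>0. packing_number P \<epsilon> F \<noteq> \<infinity> \<and>
           ln (real (the_enat (packing_number P \<epsilon> F))) \<le> 16 * C\<^sup>2 / \<epsilon>\<^sup>2 + 2 * ln 2"
proof (intro allI impI)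
  fix \<epsilon> :: real assume "0 < \<epsilon>"
  define M where "M = 16 * C\<^sup>2 / \<epsilon>\<^sup>2 + 2 * ln 2"
  have M: "0 \<le> M" by (simp add: M_def)
  have "real (card S) \<le> exp M" if S: "is_packing P \<epsilon> F S" "finite S" for S
  proof (cases "S = {}")
    case False
    note bound = ln_packing_bound[OF assms(1,2,4,6,7) S False \<open>0 < \<epsilon>\<close>]
    have "ln (real (card S)) \<le> M"
    \<comment> \<open>The choice \<tau> = 8C/\<epsilon>^2 is positive only for \<open>C > 0\<close>;
      for \<open>C = 0\<close> any \<tau> gives the bound \<open>ln 2\<close>.\<close>
    proof (cases "C = 0")
      case True
      then have "ln (real (card S)) \<le> ln 2" using bound[of 1] by simp
      also have "\<dots> \<le> M" using True by (simp add: M_def)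
      finally show ?thesis .
    next
      case False
      with \<open>C \<ge> 0\<close> have "C > 0" by simp
      then have "0 < 8 * C / \<epsilon>\<^sup>2" using \<open>0 < \<epsilon>\<close> by simp
      \<comment> \<open>The factor on the left of \<open>ln_packing_bound\<close> becomes 1/2;
        doubling yields both 16 and \<open>2 * ln 2\<close>.\<close>
      moreover have "4 * C / (8 * C / \<epsilon>\<^sup>2 * \<epsilon>\<^sup>2) = 1 / 2"
        using \<open>C > 0\<close> \<open>0 < \<epsilon>\<close> by simp
      ultimately show ?thesis
        using bound[of "8 * C / \<epsilon>\<^sup>2"] by (simp add: M_def power2_eq_square)
    qed
    then show ?thesis
      using S(2) False ln_le_cancel_iff[of "real (card S)" "exp M"] by (simp add: card_gt_0_iff)
  qed simp
  from packing_number_bound[OF this]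
  have "packing_number P \<epsilon> F \<noteq> \<infinity>" and le: "real (the_enat (packing_number P \<epsilon> F)) \<le> exp M"
    by auto
  moreover have "ln (real (the_enat (packing_number P \<epsilon> F))) \<le> M"
  \<comment> \<open>At the value 0 the convention \<open>ln 0 = 0\<close> applies, and
    \<open>M\<close> is nonnegative.\<close>
  proof (cases "the_enat (packing_number P \<epsilon> F) = 0")
    case False
    then show ?thesis using le ln_le_cancel_iff[of "real (the_enat (packing_number P \<epsilon> F))" "exp M"] by simp
  qed (use M in simp)
  ultimately show "packing_number P \<epsilon> F \<noteq> \<infinity> \<and>
      ln (real (the_enat (packing_number P \<epsilon> F))) \<le> 16 * C\<^sup>2 / \<epsilon>\<^sup>2 + 2 * ln 2"
    by (simp add: M_def)
qed

end
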